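(* Consider a discrete Nash equilibrium problem in which, for every player $\nu\in\{1,\dots,N\}$, $$\theta_\nu(\mathbf{x})=\tfrac12 (x^\nu)^TQ^\nu x^\nu+\left(C^\nu\mathbf{x}^{-\nu}+b^\nu\right)^Tx^\nu,$$ with $Q^\nu\in\mathbb{R}^{n_\nu\times n_\nu}$, $C^\nu\in\mathbb{R}^{n_\nu\times(n-n_\nu)}$, $b^\nu\in\mathbb{R}^{n_\nu}$, and in which $X=\{\mathbf{x}\in\mathbb{R}^n:\mathbf{l}\le\mathbf{x}\le\mathbf{u}\}$, with $\mathbf{l},\mathbf{u}\in\mathbb{Z}^n$, is non-empty and bounded. Then the Gauss-Seidel lower bound method (described in the context) returns a point $\mathbf{l}^*$ in a finite number of iterations, and every solution $\mathbf{x}^*$ of the discrete Nash equilibrium problem satisfies $\mathbf{l}^*\le\mathbf{x}^*$ (componentwise).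
   Context: There are $N$ players; player $\nu$ controls $x^\nu\in\mathbb{R}^{n_\nu}$; $n=n_1+\dots+n_N$, $\mathbf{x}=(x^1,\dots,x^N)=(x^\nu,\mathbf{x}^{-\nu})\in\mathbb{R}^n$, where $\mathbf{x}^{-\nu}$ collects the variables of all players other than $\nu$. Components of vectors in $\mathbb{R}^n$ such as $\mathbf{l},\mathbf{u},\mathbf{y},\mathbf{z}$ are indexed in the same way ($l^\nu_i$, etc.). $X=\prod_\nu X^\nu$, where here $X^\nu=\{x^\nu: l^\nu\le x^\nu\le u^\nu\}$. In the discrete Nash equilibrium problem each player $\nu$ solves $\min_{x^\nu}\theta_\nu(x^\nu,\mathbf{x}^{-\nu})$ subject to $x^\nu\in X^\nu\cap\mathbb{Z}^{n_\nu}$. A solution is a point $\mathbf{x}_*\in X\cap\mathbb{Z}^n$ such that for all $\nu$, $\theta_\nu(x^\nu_*,\mathbf{x}^{-\nu}_* )\le\theta_\nu(x^\nu,\mathbf{x}^{-\nu}_* )$ for all $x^\nu\in X^\nu\cap\mathbb{Z}^{n_\nu}$. Standing assumption: each $\theta_\nu$ is convex as a function of $x^\nu$ alone. $F^\nu(\mathbf{x}):=\nabla_{x^\nu}\theta_\nu(\mathbf{x})$, with components $F^\nu_i$ (affine here, so their partial derivatives are constants). Gauss-Seidel lower bound method: (S.0) Set $\mathbf{w}:=\mathbf{l}$ and $\mathbf{y}:=\mathbf{l}$. (S.1) Set $\nu:=1$. (S.2) Set $i:=1$. (S.3) Define $\mathbf{z}\in\mathbb{Z}^n$ by, for all $\mu\in\{1,\dots,N\}$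 and $j\in\{1,\dots,n_\mu\}$: $z^\mu_j:=y^\mu_j$ if $\frac{\partial F^\nu_i}{\partial x^\mu_j}\le0$ and $z^\mu_j:=u^\mu_j$ otherwise. (S.4) For $s\in\mathbb{Z}$ write $\phi(s):=\theta_\nu\big((z^\nu_1,\dots,z^\nu_{i-1},s,z^\nu_{i+1},\dots,z^\nu_{n_\nu})^T,\mathbf{z}^{-\nu}\big)$. Compute $s\in\mathbb{Z}$ with $y^\nu_i\le s\le u^\nu_i$ such that: if $s+1\le u^\nu_i$ then $\phi(s)\le\phi(s+1)$; and if $y^\nu_i\le s-1$ then $\phi(s-1)>\phi(s)$. (S.5) Set $y^\nu_i:=s$. (S.6) Set $i:=i+1$. If $i\le n_\nu$ go to (S.3). Otherwise set $\nu:=\nu+1$, and if $\nu\le N$ go to (S.2). (S.7) If $\mathbf{w}=\mathbf{y}$ then stop and return $\mathbf{l}^*:=\mathbf{y}$. Else set $\mathbf{w}:=\mathbf{y}$ and go to (S.1). *)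

theory Defs
  imports "HOL-Analysis.Analysis"
begin

text \<open>
  Player \<open>\<nu> \<in> {1..N}\<close> controls \<open>n \<nu>\<close> variables. A vector of \<open>\<real>\<^sup>n\<close>, \<open>n = n\<^sub>1 + \<dots> + n\<^sub>N\<close>, is
  represented by its components \<open>x \<nu> i\<close> with \<open>\<nu> \<in> {1..N}\<close> and \<open>i \<in> {1..n \<nu>}\<close>; values at other
  arguments carry no meaning, and every comparison below is restricted to the components.
\<close>

type_synonym 'a profile = "nat \<Rightarrow> nat \<Rightarrow> 'a"

definition embed :: "int profile \<Rightarrow> real profile" where
  "embed y = (\<lambda>\<nu> i. real_of_int (y \<nu> i))"

definition set_comp :: "'a profile \<Rightarrow> nat \<Rightarrow> nat \<Rightarrow> 'a \<Rightarrow> 'a profile" where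
  "set_comp x \<mu> j t = x(\<mu> := (x \<mu>)(j := t))"

definition strategies :: "(nat \<Rightarrow> nat) \<Rightarrow> int profile \<Rightarrow> int profile \<Rightarrow> nat \<Rightarrow> (nat \<Rightarrow> real) set" where
  "strategies n l u \<nu> =
     {\<xi>. \<forall>i\<in>{1..n \<nu>}. real_of_int (l \<nu> i) \<le> \<xi> i \<and> \<xi> i \<le> real_of_int (u \<nu> i)}"

definition integral_strategies :: "(nat \<Rightarrow> nat) \<Rightarrow> nat \<Rightarrow> (nat \<Rightarrow> real) set" where
  "integral_strategies n \<nu> = {\<xi>. \<forall>i\<in>{1..n \<nu>}. \<xi> i \<in> \<int>}"

definition feasible_set :: "nat \<Rightarrow> (nat \<Rightarrow> nat) \<Rightarrow> int profile \<Rightarrow> int profile \<Rightarrow> real profile set" where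
  "feasible_set N n l u = {x. \<forall>\<nu>\<in>{1..N}. x \<nu> \<in> strategies n l u \<nu>}"

definition integral_profiles :: "nat \<Rightarrow> (nat \<Rightarrow> nat) \<Rightarrow> real profile set" where
  "integral_profiles N n = {x. \<forall>\<nu>\<in>{1..N}. x \<nu> \<in> integral_strategies n \<nu>}"

definition bounded_profiles :: "nat \<Rightarrow> (nat \<Rightarrow> nat) \<Rightarrow> real profile set \<Rightarrow> bool" where
  "bounded_profiles N n A \<longleftrightarrow> (\<exists>B. \<forall>x\<in>A. \<forall>\<nu>\<in>{1..N}. \<forall>i\<in>{1..n \<nu>}. \<bar>x \<nu> i\<bar> \<le> B)"

definition is_discrete_nash ::
  "nat \<Rightarrow> (nat \<Rightarrow> nat) \<Rightarrow> (nat \<Rightarrow> real profile \<Rightarrow> real) \<Rightarrow> int profile \<Rightarrow> int profile \<Rightarrow> real profile \<Rightarrow> bool"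
where
  "is_discrete_nash N n \<theta> l u x \<longleftrightarrow>
     x \<in> feasible_set N n l u \<inter> integral_profiles N n \<and>
     (\<forall>\<nu>\<in>{1..N}. \<forall>\<xi> \<in> strategies n l u \<nu> \<inter> integral_strategies n \<nu>. \<theta> \<nu> x \<le> \<theta> \<nu> (x(\<nu> := \<xi>)))"

text \<open>This unfolds \<^const>\<open>convex_on\<close>; function types are not in class \<open>real_vector\<close>.\<close>

definition convex_in_own_variables :: "nat \<Rightarrow> (nat \<Rightarrow> real profile \<Rightarrow> real) \<Rightarrow> bool" where
  "convex_in_own_variables N \<theta> \<longleftrightarrow>
     (\<forall>\<nu>\<in>{1..N}. \<forall>x \<xi> \<eta>. \<forall>t\<in>{0..1}.
        \<theta> \<nu> (x(\<nu> := (\<lambda>i. (1 - t) * \<xi> i + t * \<eta> i)))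
          \<le> (1 - t) * \<theta> \<nu> (x(\<nu> := \<xi>)) + t * \<theta> \<nu> (x(\<nu> := \<eta>)))"

definition partial_deriv :: "(real profile \<Rightarrow> real) \<Rightarrow> nat \<Rightarrow> nat \<Rightarrow> real profile \<Rightarrow> real" where
  "partial_deriv f \<mu> j x = deriv (\<lambda>t. f (set_comp x \<mu> j t)) (x \<mu> j)"

definition grad_comp :: "(nat \<Rightarrow> real profile \<Rightarrow> real) \<Rightarrow> nat \<Rightarrow> nat \<Rightarrow> real profile \<Rightarrow> real" where
  "grad_comp \<theta> \<nu> i x = partial_deriv (\<theta> \<nu>) \<nu> i x"

text \<open>
  The point \<open>z\<close> of step S.3. The partial derivatives are evaluated at the current iterate \<open>y\<close>;
  for the quadratic costs considered here they do not depend on the point.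
\<close>

definition S3_point ::
  "(nat \<Rightarrow> real profile \<Rightarrow> real) \<Rightarrow> int profile \<Rightarrow> int profile \<Rightarrow> nat \<Rightarrow> nat \<Rightarrow> int profile" where
  "S3_point \<theta> u y \<nu> i =
     (\<lambda>\<mu> j. if partial_deriv (grad_comp \<theta> \<nu> i) \<mu> j (embed y) \<le> 0 then y \<mu> j else u \<mu> j)"

definition S4_fun ::
  "(nat \<Rightarrow> real profile \<Rightarrow> real) \<Rightarrow> int profile \<Rightarrow> nat \<Rightarrow> nat \<Rightarrow> int \<Rightarrow> real" where
  "S4_fun \<theta> z \<nu> i s = \<theta> \<nu> (embed (set_comp z \<nu> i s))"

definition S4_valid ::
  "(nat \<Rightarrow> real profile \<Rightarrow> real) \<Rightarrow> int profile \<Rightarrow> int profile \<Rightarrow> nat \<Rightarrow> nat \<Rightarrow> int \<Rightarrow> bool" where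
  "S4_valid \<theta> u y \<nu> i s \<longleftrightarrow>
     (let \<phi> = S4_fun \<theta> (S3_point \<theta> u y \<nu> i) \<nu> i in
        y \<nu> i \<le> s \<and> s \<le> u \<nu> i \<and>
        (s + 1 \<le> u \<nu> i \<longrightarrow> \<phi> s \<le> \<phi> (s + 1)) \<and>
        (y \<nu> i \<le> s - 1 \<longrightarrow> \<phi> (s - 1) > \<phi> s))"

text \<open>
  The method as a transition system. A state is the label of the step to be executed next together
  with the live program variables \<open>w\<close>, \<open>y\<close>, \<open>\<nu>\<close>, \<open>i\<close>; steps S.3 to S.5 are one
  transition, and \<open>Stop lstar\<close> is the state after \<open>lstar\<close> has been returned. The relation does not
  prescribe how \<open>s\<close> is found in S.4: every admissible \<open>s\<close> gives a transition, and if there is none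
  the method is stuck.
\<close>

datatype gs_state =
    S1 "int profile" "int profile"
  | S2 "int profile" "int profile" nat
  | S3 "int profile" "int profile" nat nat
  | S6 "int profile" "int profile" nat nat
  | S7 "int profile" "int profile"
  | Stop "int profile"

definition same_profile :: "nat \<Rightarrow> (nat \<Rightarrow> nat) \<Rightarrow> int profile \<Rightarrow> int profile \<Rightarrow> bool" where
  "same_profile N n w y \<longleftrightarrow> (\<forall>\<nu>\<in>{1..N}. \<forall>i\<in>{1..n \<nu>}. w \<nu> i = y \<nu> i)"

inductive gs_step ::
  "nat \<Rightarrow> (nat \<Rightarrow> nat) \<Rightarrow> (nat \<Rightarrow> real profile \<Rightarrow> real) \<Rightarrow> int profile \<Rightarrow> gs_state \<Rightarrow> gs_state \<Rightarrow> bool"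
  for N n \<theta> u
where
  "gs_step N n \<theta> u (S1 w y) (S2 w y 1)"
| "gs_step N n \<theta> u (S2 w y \<nu>) (S3 w y \<nu> 1)"
| "S4_valid \<theta> u y \<nu> i s \<Longrightarrow> gs_step N n \<theta> u (S3 w y \<nu> i) (S6 w (set_comp y \<nu> i s) \<nu> i)"
| "i + 1 \<le> n \<nu> \<Longrightarrow> gs_step N n \<theta> u (S6 w y \<nu> i) (S3 w y \<nu> (i + 1))"
| "\<not> i + 1 \<le> n \<nu> \<Longrightarrow> \<nu> + 1 \<le> N \<Longrightarrow> gs_step N n \<theta> u (S6 w y \<nu> i) (S2 w y (\<nu> + 1))"
| "\<not> i + 1 \<le> n \<nu> \<Longrightarrow> \<not> \<nu> + 1 \<le> N \<Longrightarrow> gs_step N n \<theta> u (S6 w y \<nu> i) (S7 w y)"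
| "same_profile N n w y \<Longrightarrow> gs_step N n \<theta> u (S7 w y) (Stop y)"
| "\<not> same_profile N n w y \<Longrightarrow> gs_step N n \<theta> u (S7 w y) (S1 y y)"

definition gs_init :: "int profile \<Rightarrow> gs_state" where
  "gs_init l = S1 l l"

definition gs_returns ::
  "nat \<Rightarrow> (nat \<Rightarrow> nat) \<Rightarrow> (nat \<Rightarrow> real profile \<Rightarrow> real) \<Rightarrow> int profile \<Rightarrow> int profile \<Rightarrow> int profile \<Rightarrow> bool"
where
  "gs_returns N n \<theta> l u lstar \<longleftrightarrow> (gs_step N n \<theta> u)\<^sup>*\<^sup>* (gs_init l) (Stop lstar)"

text \<open>
  Total correctness of the control flow: whatever admissible \<open>s\<close> are chosen, the execution is finite
  and can only end by returning a point.
\<close>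

definition gs_terminates ::
  "nat \<Rightarrow> (nat \<Rightarrow> nat) \<Rightarrow> (nat \<Rightarrow> real profile \<Rightarrow> real) \<Rightarrow> int profile \<Rightarrow> int profile \<Rightarrow> bool"
where
  "gs_terminates N n \<theta> l u \<longleftrightarrow>
     \<not> (\<exists>\<sigma>. \<sigma> 0 = gs_init l \<and> (\<forall>k::nat. gs_step N n \<theta> u (\<sigma> k) (\<sigma> (Suc k)))) \<and>
     (\<forall>\<sigma>. (gs_step N n \<theta> u)\<^sup>*\<^sup>* (gs_init l) \<sigma> \<longrightarrow>
        (\<exists>lstar. \<sigma> = Stop lstar) \<or> (\<exists>\<sigma>'. gs_step N n \<theta> u \<sigma> \<sigma>'))"

end

theory Submission
  imports Defs
begin

text \<open>
  \<^emph>\<open>Termination.\<close> A sweep never decreases a component of \<open>y\<close>, and never moves one above \<open>u\<close>. A new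
  sweep is started only if the last one changed \<open>y\<close>, hence raised some integer component, so there
  are at most \<open>\<Sum>(u - l) + 1\<close> sweeps (\<open>gs_step_decreases\<close>). Nothing can get stuck: the least minimiser
  of \<open>\<phi>\<close> on the finite set \<open>{y \<nu> i..u \<nu> i}\<close> is admissible in S.4 (\<open>S4_valid_exists\<close>). This part
  holds for arbitrary costs.

  \<^emph>\<open>Lower bound.\<close> Let \<open>x\<close> be a solution; then \<open>y \<le> x\<close> is invariant. For quadratic costs the forward
  difference of \<open>\<theta> \<nu>\<close> in component \<open>i\<close> at a point \<open>p\<close> is \<open>F p + Q \<nu> i i / 2\<close>, where \<open>F\<close> is the
  affine gradient component \<open>F\<^sup>\<nu>\<^sub>i\<close> (\<open>cost_set_comp\<close>). Suppose that S.4 returned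
  some \<open>s > x \<nu> i\<close>, and let \<open>p\<close> be the point of S.3 with component \<open>i\<close> of player \<open>\<nu>\<close> set to \<open>s - 1\<close>.
  As \<open>s - 1 \<ge> x \<nu> i \<ge> y \<nu> i\<close>, the
  second condition of S.4 says that the forward difference at \<open>p\<close> is negative. But
  \<open>F x \<le> F p\<close> holds term by term: S.3 chooses every other component so that its term in \<open>F\<close> is the
  largest possible between \<open>y\<close> and \<open>u\<close>, where \<open>x\<close> lies, and for component \<open>i\<close>
  itself the coefficient \<open>Q \<nu> i i\<close> is nonnegative by convexity while \<open>x \<nu> i \<le> s - 1\<close>. So the forward
  difference at \<open>x\<close> is negative as well, and player \<open>\<nu>\<close> gains by the feasible move from \<open>x \<nu> i\<close> to
  \<open>x \<nu> i + 1\<close>, which a solution excludes (\<open>S4_valid_le_nash\<close>).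
\<close>

section \<open>Termination of the method for arbitrary costs\<close>

lemma set_comp_apply: "set_comp x \<nu> i t \<mu> j = (if \<mu> = \<nu> \<and> j = i then t else x \<mu> j)"
  by (simp add: set_comp_def)

primrec current_point :: "gs_state \<Rightarrow> int profile" where
  "current_point (S1 w y) = y"
| "current_point (S2 w y \<nu>) = y"
| "current_point (S3 w y \<nu> i) = y"
| "current_point (S6 w y \<nu> i) = y"
| "current_point (S7 w y) = y"
| "current_point (Stop y) = y"

definition le_profile ::
  "nat \<Rightarrow> (nat \<Rightarrow> nat) \<Rightarrow> 'a::linorder profile \<Rightarrow> 'a profile \<Rightarrow> bool" where
  "le_profile N n x y \<longleftrightarrow> (\<forall>\<nu>\<in>{1..N}. \<forall>i\<in>{1..n \<nu>}. x \<nu> i \<le> y \<nu> i)"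

lemma le_profileD:
  "le_profile N n x y \<Longrightarrow> \<nu> \<in> {1..N} \<Longrightarrow> i \<in> {1..n \<nu>} \<Longrightarrow> x \<nu> i \<le> y \<nu> i"
  unfolding le_profile_def by blast

text \<open>
  \<open>w \<le> y\<close> is what turns \<open>w \<noteq> y\<close> into a strict increase at the end of a sweep; \<open>y \<le> u\<close> keeps S.4
  solvable.
\<close>

primrec gs_inv :: "nat \<Rightarrow> (nat \<Rightarrow> nat) \<Rightarrow> int profile \<Rightarrow> gs_state \<Rightarrow> bool" where
  "gs_inv N n u (S1 w y) \<longleftrightarrow> le_profile N n w y \<and> le_profile N n y u"
| "gs_inv N n u (S2 w y \<nu>) \<longleftrightarrow> le_profile N n w y \<and> le_profile N n y u \<and> \<nu> \<in> {1..N}"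
| "gs_inv N n u (S3 w y \<nu> i) \<longleftrightarrow>
     le_profile N n w y \<and> le_profile N n y u \<and> \<nu> \<in> {1..N} \<and> i \<in> {1..n \<nu>}"
| "gs_inv N n u (S6 w y \<nu> i) \<longleftrightarrow>
     le_profile N n w y \<and> le_profile N n y u \<and> \<nu> \<in> {1..N} \<and> i \<in> {1..n \<nu>}"
| "gs_inv N n u (S7 w y) \<longleftrightarrow> le_profile N n w y \<and> le_profile N n y u"
| "gs_inv N n u (Stop y) \<longleftrightarrow> le_profile N n y u"

definition slack :: "nat \<Rightarrow> (nat \<Rightarrow> nat) \<Rightarrow> int profile \<Rightarrow> int profile \<Rightarrow> nat" where
  "slack N n u w = (\<Sum>\<nu>\<in>{1..N}. \<Sum>i\<in>{1..n \<nu>}. nat (u \<nu> i - w \<nu> i))"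

lemma slack_less:
  assumes wy: "le_profile N n w y" and yu: "le_profile N n y u" and "\<not> same_profile N n w y"
  shows "slack N n u y < slack N n u w"
proof -
  obtain \<nu> i where \<nu>: "\<nu> \<in> {1..N}" and i: "i \<in> {1..n \<nu>}" and ne: "w \<nu> i \<noteq> y \<nu> i"
    using assms(3) unfolding same_profile_def by blast
  have le: "nat (u \<mu> j - y \<mu> j) \<le> nat (u \<mu> j - w \<mu> j)" if "\<mu> \<in> {1..N}" "j \<in> {1..n \<mu>}" for \<mu> j
    using le_profileD[OF wy that] by simp
  have "nat (u \<nu> i - y \<nu> i) < nat (u \<nu> i - w \<nu> i)"
    using le_profileD[OF wy \<nu> i] le_profileD[OF yu \<nu> i] ne by simp
  then have "(\<Sum>i\<in>{1..n \<nu>}. nat (u \<nu> i - y \<nu> i)) < (\<Sum>i\<in>{1..n \<nu>}. nat (u \<nu> i - w \<nu> i))"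
    using le \<nu> i by (intro sum_strict_mono_ex1) blast+
  then show ?thesis
    unfolding slack_def using \<nu> by (intro sum_strict_mono_ex1) (auto intro!: sum_mono le)
qed

text \<open>
  Position of the program counter, read from the outermost loop inwards: remaining slack of the
  point \<open>w\<close> at which the sweep began, players left, variables left, and S.3 before S.6.
\<close>

primrec sweep_rank :: "nat \<Rightarrow> (nat \<Rightarrow> nat) \<Rightarrow> int profile \<Rightarrow> gs_state \<Rightarrow> nat" where
  "sweep_rank N n u (S1 w y) = Suc (slack N n u w)"
| "sweep_rank N n u (S2 w y \<nu>) = Suc (slack N n u w)"
| "sweep_rank N n u (S3 w y \<nu> i) = Suc (slack N n u w)"
| "sweep_rank N n u (S6 w y \<nu> i) = Suc (slack N n u w)"
| "sweep_rank N n u (S7 w y) = Suc (slack N n u w)"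
| "sweep_rank N n u (Stop y) = 0"

primrec player_rank :: "nat \<Rightarrow> gs_state \<Rightarrow> nat" where
  "player_rank N (S1 w y) = Suc N"
| "player_rank N (S2 w y \<nu>) = Suc N - \<nu>"
| "player_rank N (S3 w y \<nu> i) = Suc N - \<nu>"
| "player_rank N (S6 w y \<nu> i) = Suc N - \<nu>"
| "player_rank N (S7 w y) = 0"
| "player_rank N (Stop y) = 0"

primrec variable_rank :: "(nat \<Rightarrow> nat) \<Rightarrow> gs_state \<Rightarrow> nat" where
  "variable_rank n (S1 w y) = 0"
| "variable_rank n (S2 w y \<nu>) = Suc (n \<nu>)"
| "variable_rank n (S3 w y \<nu> i) = Suc (n \<nu>) - i"
| "variable_rank n (S6 w y \<nu> i) = Suc (n \<nu>) - i"
| "variable_rank n (S7 w y) = 0"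
| "variable_rank n (Stop y) = 0"

primrec update_rank :: "gs_state \<Rightarrow> nat" where
  "update_rank (S1 w y) = 0"
| "update_rank (S2 w y \<nu>) = 0"
| "update_rank (S3 w y \<nu> i) = 1"
| "update_rank (S6 w y \<nu> i) = 0"
| "update_rank (S7 w y) = 0"
| "update_rank (Stop y) = 0"

lemma gs_step_decreases:
  assumes "gs_step N n \<theta> u \<sigma> \<sigma>'" and "gs_inv N n u \<sigma>"
    and "\<And>\<nu>. \<nu> \<in> {1..N} \<Longrightarrow> 1 \<le> n \<nu>"
  shows "(\<sigma>', \<sigma>) \<in> measures [sweep_rank N n u, player_rank N, variable_rank n, update_rank]"
  using assms by cases (auto dest: slack_less)

lemma gs_step_inv:
  assumes "gs_step N n \<theta> u \<sigma> \<sigma>'" and "gs_inv N n u \<sigma>"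
    and "1 \<le> N" and "\<And>\<nu>. \<nu> \<in> {1..N} \<Longrightarrow> 1 \<le> n \<nu>"
  shows "gs_inv N n u \<sigma>'"
  using assms(1)
proof cases
  case (3 y \<nu> i s w)
  then have "y \<nu> i \<le> s" "s \<le> u \<nu> i" "w \<nu> i \<le> y \<nu> i"
    using assms(2) by (auto simp: S4_valid_def Let_def le_profile_def)
  then have "w \<nu> i \<le> s" "s \<le> u \<nu> i"
    by simp_all
  then show ?thesis
    using 3 assms(2) by (auto simp: le_profile_def set_comp_apply)
qed (use assms(2-4) in \<open>auto simp: le_profile_def\<close>)

text \<open>
  A minimiser of \<open>\<phi>\<close> on the interval satisfies the first condition of S.4; taking the least one makes
  the comparison with its left neighbour strict.
\<close>

lemma S4_valid_exists:
  assumes "y \<nu> i \<le> u \<nu> i"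
  shows "\<exists>s. S4_valid \<theta> u y \<nu> i s"
proof -
  define \<phi> where "\<phi> = S4_fun \<theta> (S3_point \<theta> u y \<nu> i) \<nu> i"
  define I where "I = {y \<nu> i..u \<nu> i}"
  define M where "M = {s\<in>I. \<forall>t\<in>I. \<phi> s \<le> \<phi> t}"
  have "finite I" "I \<noteq> {}"
    using assms by (auto simp: I_def)
  then obtain s where "s \<in> I" "\<forall>t\<in>I. \<phi> s \<le> \<phi> t"
    using arg_min_if_finite[of I \<phi>] by (metis not_less)
  then have "M \<noteq> {}" "finite M"
    using \<open>finite I\<close> by (auto simp: M_def)
  define m where "m = Min M"
  have m: "m \<in> M"
    unfolding m_def using \<open>M \<noteq> {}\<close> \<open>finite M\<close> by (rule Min_in[rotated])
  have "m - 1 \<notin> M"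
    using Min_le[OF \<open>finite M\<close>, of "m - 1"] by (auto simp: m_def)
  then have "\<phi> (m - 1) > \<phi> m" if "y \<nu> i \<le> m - 1"
    using m that by (force simp: M_def I_def)
  then have "S4_valid \<theta> u y \<nu> i m"
    using m by (auto simp: S4_valid_def Let_def \<phi>_def[symmetric] M_def I_def)
  then show ?thesis ..
qed

lemma gs_step_progress:
  assumes "gs_inv N n u \<sigma>"
  shows "(\<exists>lstar. \<sigma> = Stop lstar) \<or> (\<exists>\<sigma>'. gs_step N n \<theta> u \<sigma> \<sigma>')"
proof (cases \<sigma>)
  case (S3 w y \<nu> i)
  then have "y \<nu> i \<le> u \<nu> i"
    using assms by (auto intro: le_profileD)
  then show ?thesis
    using S4_valid_exists S3 gs_step.intros(3) by metis
qed (metis gs_step.intros)+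

lemma gs_reachable_inv:
  assumes "(gs_step N n \<theta> u)\<^sup>*\<^sup>* \<sigma> \<sigma>'" and "gs_inv N n u \<sigma>"
    and "1 \<le> N" and "\<And>\<nu>. \<nu> \<in> {1..N} \<Longrightarrow> 1 \<le> n \<nu>"
  shows "gs_inv N n u \<sigma>'"
  using assms by (induction rule: rtranclp_induct) (blast intro: gs_step_inv)+

lemma gs_terminates_and_returns:
  assumes N: "1 \<le> N" and n: "\<And>\<nu>. \<nu> \<in> {1..N} \<Longrightarrow> 1 \<le> n \<nu>" and lu: "le_profile N n l u"
  shows "gs_terminates N n \<theta> l u" and "\<exists>lstar. gs_returns N n \<theta> l u lstar"
proof -
  let ?r = "measures [sweep_rank N n u, player_rank N, variable_rank n, update_rank]"
  let ?R = "{\<sigma>. (gs_step N n \<theta> u)\<^sup>*\<^sup>* (gs_init l) \<sigma>}"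
  have init: "gs_inv N n u (gs_init l)"
    using lu by (simp add: gs_init_def le_profile_def)
  have inv: "gs_inv N n u \<sigma>" if "\<sigma> \<in> ?R" for \<sigma>
    using gs_reachable_inv[of N n \<theta> u, OF _ init N n] that by simp
  have dec: "(\<sigma>', \<sigma>) \<in> ?r" if "\<sigma> \<in> ?R" "gs_step N n \<theta> u \<sigma> \<sigma>'" for \<sigma> \<sigma>'
    using gs_step_decreases[OF that(2) inv[OF that(1)] n] .
  have "\<not> (\<forall>k. gs_step N n \<theta> u (f k) (f (Suc k)))" if "f 0 = gs_init l" for f
  proof
    assume step: "\<forall>k. gs_step N n \<theta> u (f k) (f (Suc k))"
    have "f k \<in> ?R" for k
      by (induction k) (use that step in \<open>auto intro: rtranclp.rtrancl_into_rtrancl\<close>)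
    then have "\<forall>k. (f (Suc k), f k) \<in> ?r"
      using step dec by blast
    then show False
      using wf_iff_no_infinite_down_chain[of ?r] wf_measures by blast
  qed
  then show "gs_terminates N n \<theta> l u"
    unfolding gs_terminates_def using gs_step_progress[OF inv] by blast
  \<comment> \<open>A reachable state of least rank has no successor, so it has returned a point.\<close>
  have "gs_init l \<in> ?R"
    by simp
  then obtain \<sigma> where \<sigma>: "\<sigma> \<in> ?R" and min: "\<And>\<sigma>'. (\<sigma>', \<sigma>) \<in> ?r \<Longrightarrow> \<sigma>' \<notin> ?R"
    using wfE_min[OF wf_measures] by metis
  have "\<not> gs_step N n \<theta> u \<sigma> \<sigma>'" for \<sigma>'
  proof
    assume step: "gs_step N n \<theta> u \<sigma> \<sigma>'"
    then have "\<sigma>' \<in> ?R"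
      using \<sigma> by (auto intro: rtranclp.rtrancl_into_rtrancl)
    then show False
      using min dec[OF \<sigma> step] by blast
  qed
  then obtain lstar where "\<sigma> = Stop lstar"
    using gs_step_progress[OF inv[OF \<sigma>]] by blast
  then show "\<exists>lstar. gs_returns N n \<theta> l u lstar"
    unfolding gs_returns_def using \<sigma> by blast
qed

section \<open>Quadratic costs along one coordinate\<close>

lemma linear_sum_update:
  fixes v :: "'a \<Rightarrow> real"
  assumes "finite A" and "a \<in> A"
  shows "(\<Sum>k\<in>A. c k * (v(a := t)) k) = (\<Sum>k\<in>A. c k * v k) + (t - v a) * c a"
proof -
  have "(\<Sum>k\<in>A. c k * (v(a := t)) k) = (\<Sum>k\<in>A. c k * v k + (if k = a then (t - v a) * c a else 0))"
    by (intro sum.cong) (auto simp: algebra_simps)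
  then show ?thesis
    using assms by (simp add: sum.distrib)
qed

lemma bilinear_sum_update:
  fixes v :: "'a \<Rightarrow> real"
  assumes "finite A" and "a \<in> A"
  shows "(\<Sum>k\<in>A. (v(a := t)) k * (\<Sum>j\<in>A. Q k j * (v(a := t)) j)) =
    (\<Sum>k\<in>A. v k * (\<Sum>j\<in>A. Q k j * v j)) + (t - v a) * (\<Sum>j\<in>A. (Q a j + Q j a) * v j)
      + (t - v a)\<^sup>2 * Q a a"
proof -
  let ?d = "t - v a"
  let ?S = "\<lambda>k. \<Sum>j\<in>A. Q k j * v j"
  have "(\<Sum>k\<in>A. (v(a := t)) k * (\<Sum>j\<in>A. Q k j * (v(a := t)) j)) =
      (\<Sum>k\<in>A. (?S k + ?d * Q k a) * (v(a := t)) k)"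
    by (intro sum.cong refl) (simp only: linear_sum_update[OF assms] mult.commute)
  also have "\<dots> = (\<Sum>k\<in>A. (?S k + ?d * Q k a) * v k) + ?d * (?S a + ?d * Q a a)"
    by (rule linear_sum_update[OF assms])
  finally show ?thesis
    by (simp add: algebra_simps sum.distrib sum_distrib_left sum_subtractf power2_eq_square)
qed

lemma deriv_expansion:
  fixes f :: "real \<Rightarrow> real"
  assumes "\<And>t. f t = c + (t - a) * m + (t - a)\<^sup>2 * q"
  shows "deriv f a = m"
proof -
  have "((\<lambda>t. c + (t - a) * m + (t - a)\<^sup>2 * q) has_real_derivative m) (at a)"
    by (auto intro!: derivative_eq_intros)
  moreover have "f = (\<lambda>t. c + (t - a) * m + (t - a)\<^sup>2 * q)"
    using assms by (rule ext)
  ultimately show ?thesis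
    by (simp add: DERIV_imp_deriv)
qed

locale quadratic_game =
  fixes N :: nat
    and n :: "nat \<Rightarrow> nat"
    and \<theta> :: "nat \<Rightarrow> real profile \<Rightarrow> real"
    and Q :: "nat \<Rightarrow> nat \<Rightarrow> nat \<Rightarrow> real"
    and C :: "nat \<Rightarrow> nat \<Rightarrow> nat \<Rightarrow> nat \<Rightarrow> real"
    and b :: "nat \<Rightarrow> nat \<Rightarrow> real"
  assumes quadratic: "\<And>\<nu> x. \<nu> \<in> {1..N} \<Longrightarrow>
      \<theta> \<nu> x = 1/2 * (\<Sum>i=1..n \<nu>. x \<nu> i * (\<Sum>j=1..n \<nu>. Q \<nu> i j * x \<nu> j))
        + (\<Sum>i=1..n \<nu>. ((\<Sum>\<mu>\<in>{1..N} - {\<nu>}. \<Sum>j=1..n \<mu>. C \<nu> i \<mu> j * x \<mu> j) + b \<nu> i) * x \<nu> i)"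
    and convex: "convex_in_own_variables N \<theta>"
begin

text \<open>
  The constant partial derivatives of \<open>F\<^sup>\<nu>\<^sub>i\<close>. As \<open>Q \<nu>\<close> may be asymmetric, its symmetric part enters.
\<close>

definition grad_coeff :: "nat \<Rightarrow> nat \<Rightarrow> nat \<Rightarrow> nat \<Rightarrow> real" where
  "grad_coeff \<nu> i \<mu> j = (if \<mu> = \<nu> then (Q \<nu> i j + Q \<nu> j i) / 2 else C \<nu> i \<mu> j)"

definition affine_grad :: "nat \<Rightarrow> nat \<Rightarrow> real profile \<Rightarrow> real" where
  "affine_grad \<nu> i x = (\<Sum>\<mu>\<in>{1..N}. \<Sum>j=1..n \<mu>. grad_coeff \<nu> i \<mu> j * x \<mu> j) + b \<nu> i"

lemma affine_grad_split:
  assumes "\<nu> \<in> {1..N}"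
  shows "affine_grad \<nu> i x = (\<Sum>j=1..n \<nu>. (Q \<nu> i j + Q \<nu> j i) * x \<nu> j) / 2
    + ((\<Sum>\<mu>\<in>{1..N} - {\<nu>}. \<Sum>j=1..n \<mu>. C \<nu> i \<mu> j * x \<mu> j) + b \<nu> i)"
proof -
  have "affine_grad \<nu> i x = (\<Sum>j=1..n \<nu>. grad_coeff \<nu> i \<nu> j * x \<nu> j)
    + (\<Sum>\<mu>\<in>{1..N} - {\<nu>}. \<Sum>j=1..n \<mu>. grad_coeff \<nu> i \<mu> j * x \<mu> j) + b \<nu> i"
    unfolding affine_grad_def by (subst sum.remove[OF _ assms]) auto
  also have "(\<Sum>j=1..n \<nu>. grad_coeff \<nu> i \<nu> j * x \<nu> j) = (\<Sum>j=1..n \<nu>. (Q \<nu> i j + Q \<nu> j i) * x \<nu> j) / 2"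
    by (simp add: grad_coeff_def sum_divide_distrib)
  also have "(\<Sum>\<mu>\<in>{1..N} - {\<nu>}. \<Sum>j=1..n \<mu>. grad_coeff \<nu> i \<mu> j * x \<mu> j) =
      (\<Sum>\<mu>\<in>{1..N} - {\<nu>}. \<Sum>j=1..n \<mu>. C \<nu> i \<mu> j * x \<mu> j)"
    by (intro sum.cong) (auto simp: grad_coeff_def)
  finally show ?thesis
    by simp
qed

text \<open>The exact second-order Taylor expansion of the cost in a single variable.\<close>

lemma cost_set_comp:
  assumes \<nu>: "\<nu> \<in> {1..N}" and i: "i \<in> {1..n \<nu>}"
  shows "\<theta> \<nu> (set_comp x \<nu> i t) =
    \<theta> \<nu> x + (t - x \<nu> i) * affine_grad \<nu> i x + (t - x \<nu> i)\<^sup>2 * (Q \<nu> i i / 2)"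
proof -
  let ?x = "set_comp x \<nu> i t"
  let ?c = "\<lambda>k. (\<Sum>\<mu>\<in>{1..N} - {\<nu>}. \<Sum>j=1..n \<mu>. C \<nu> k \<mu> j * x \<mu> j) + b \<nu> k"
  have own: "?x \<nu> = (x \<nu>)(i := t)"
    by (simp add: set_comp_def)
  have rivals: "(\<Sum>\<mu>\<in>{1..N} - {\<nu>}. \<Sum>j=1..n \<mu>. C \<nu> k \<mu> j * ?x \<mu> j) + b \<nu> k = ?c k" for k
    by (simp add: set_comp_def)
  have "\<theta> \<nu> ?x =
      1/2 * (\<Sum>k=1..n \<nu>. ((x \<nu>)(i := t)) k * (\<Sum>j=1..n \<nu>. Q \<nu> k j * ((x \<nu>)(i := t)) j))
        + (\<Sum>k=1..n \<nu>. ?c k * ((x \<nu>)(i := t)) k)"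
    unfolding quadratic[OF \<nu>] rivals unfolding own ..
  also have "\<dots> = \<theta> \<nu> x + (t - x \<nu> i) * affine_grad \<nu> i x + (t - x \<nu> i)\<^sup>2 * (Q \<nu> i i / 2)"
    unfolding bilinear_sum_update[OF finite_atLeastAtMost i, of "x \<nu>" t "Q \<nu>"]
      linear_sum_update[OF finite_atLeastAtMost i, of ?c "x \<nu>" t]
      affine_grad_split[OF \<nu>] quadratic[OF \<nu>, of x]
    by (simp add: distrib_left distrib_right)
  finally show ?thesis .
qed

lemma grad_comp_eq:
  assumes "\<nu> \<in> {1..N}" and "i \<in> {1..n \<nu>}"
  shows "grad_comp \<theta> \<nu> i = affine_grad \<nu> i"
  unfolding grad_comp_def partial_deriv_def
  by (intro ext deriv_expansion) (rule cost_set_comp[OF assms])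

lemma affine_grad_set_comp:
  assumes \<mu>: "\<mu> \<in> {1..N}" and j: "j \<in> {1..n \<mu>}"
  shows "affine_grad \<nu> i (set_comp x \<mu> j t) = affine_grad \<nu> i x + (t - x \<mu> j) * grad_coeff \<nu> i \<mu> j"
proof -
  have "(\<Sum>k=1..n \<kappa>. grad_coeff \<nu> i \<kappa> k * set_comp x \<mu> j t \<kappa> k) =
      (\<Sum>k=1..n \<kappa>. grad_coeff \<nu> i \<kappa> k * x \<kappa> k)
        + (if \<kappa> = \<mu> then (t - x \<mu> j) * grad_coeff \<nu> i \<mu> j else 0)" for \<kappa>
    using linear_sum_update[OF finite_atLeastAtMost j, of "grad_coeff \<nu> i \<mu>" "x \<mu>" t]
    by (auto simp: set_comp_def)
  then show ?thesis
    using \<mu> by (simp add: affine_grad_def sum.distrib)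
qed

lemma partial_deriv_grad_comp:
  assumes "\<nu> \<in> {1..N}" and "i \<in> {1..n \<nu>}" and "\<mu> \<in> {1..N}" and "j \<in> {1..n \<mu>}"
  shows "partial_deriv (grad_comp \<theta> \<nu> i) \<mu> j x = grad_coeff \<nu> i \<mu> j"
  unfolding partial_deriv_def grad_comp_eq[OF assms(1,2)] affine_grad_set_comp[OF assms(3,4)]
  by (rule deriv_expansion[where q = 0]) simp

text \<open>
  In the midpoint convexity inequality on the segment from the origin to a unit vector, the
  constant and linear terms of the cost cancel.
\<close>

lemma diagonal_nonneg:
  assumes \<nu>: "\<nu> \<in> {1..N}" and i: "i \<in> {1..n \<nu>}"
  shows "0 \<le> Q \<nu> i i"
proof -
  define x where "x = (\<lambda>(\<mu>::nat) (j::nat). 0 :: real)"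
  have shift: "x(\<nu> := (\<lambda>k. if k = i then t else 0)) = set_comp x \<nu> i t" for t
    by (auto simp: set_comp_def x_def fun_eq_iff)
  note convex[unfolded convex_in_own_variables_def, rule_format, OF \<nu>, where t = "1/2" and x = x
      and \<xi> = "\<lambda>_. 0" and \<eta> = "\<lambda>k. if k = i then 1 else 0"]
  then have "\<theta> \<nu> (set_comp x \<nu> i (1/2)) \<le> \<theta> \<nu> (set_comp x \<nu> i 0) / 2 + \<theta> \<nu> (set_comp x \<nu> i 1) / 2"
    by (simp add: if_distrib cong: if_cong flip: shift)
  then show ?thesis
    unfolding cost_set_comp[OF \<nu> i] by (simp add: x_def power2_eq_square field_simps)
qed

section \<open>The iterates stay below every solution\<close>

text \<open>
  If \<open>s\<close> exceeded \<open>x \<nu> i\<close>, the strict descent that S.4 demands just below \<open>s\<close> would carry over to a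
  strict descent of the cost at \<open>x\<close>, because \<open>F\<^sup>\<nu>\<^sub>i\<close> is at least as large at the point \<open>p\<close> as at \<open>x\<close>.
\<close>

lemma S4_valid_le_nash:
  assumes \<nu>: "\<nu> \<in> {1..N}" and i: "i \<in> {1..n \<nu>}"
    and nash: "is_discrete_nash N n \<theta> l u x"
    and yx: "le_profile N n (embed y) x"
    and valid: "S4_valid \<theta> u y \<nu> i s"
  shows "real_of_int s \<le> x \<nu> i"
proof (rule ccontr)
  assume "\<not> real_of_int s \<le> x \<nu> i"
  have box: "real_of_int (l \<mu> j) \<le> x \<mu> j" "x \<mu> j \<le> real_of_int (u \<mu> j)" "x \<mu> j \<in> \<int>"
    if "\<mu> \<in> {1..N}" "j \<in> {1..n \<mu>}" for \<mu> j
    using nash that by (auto simp: is_discrete_nash_def feasible_set_def strategies_def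
        integral_profiles_def integral_strategies_def)
  obtain k where k: "x \<nu> i = real_of_int k"
    using box(3)[OF \<nu> i] by (auto elim: Ints_cases)
  have ks: "k \<le> s - 1"
    using \<open>\<not> real_of_int s \<le> x \<nu> i\<close> k by simp
  have "y \<nu> i \<le> k"
    using le_profileD[OF yx \<nu> i] k by (simp add: embed_def)
  define z where "z = S3_point \<theta> u y \<nu> i"
  \<comment> \<open>The strict inequality of S.4 compares \<open>s\<close> with \<open>s - 1\<close>; read as a forward difference, it is
    based at \<open>s - 1\<close>.\<close>
  define p where "p = set_comp (embed z) \<nu> i (real_of_int (s - 1))"
  have "S4_fun \<theta> z \<nu> i (s - 1) > S4_fun \<theta> z \<nu> i s" and "s \<le> u \<nu> i"
    using valid \<open>y \<nu> i \<le> k\<close> ks by (auto simp: S4_valid_def Let_def z_def)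
  moreover have "embed (set_comp z \<nu> i (s - 1)) = p"
    and "embed (set_comp z \<nu> i s) = set_comp p \<nu> i (p \<nu> i + 1)"
    by (auto simp: p_def embed_def set_comp_def fun_eq_iff)
  ultimately have "\<theta> \<nu> (set_comp p \<nu> i (p \<nu> i + 1)) < \<theta> \<nu> p"
    by (simp add: S4_fun_def)
  then have p_descent: "affine_grad \<nu> i p + Q \<nu> i i / 2 < 0"
    unfolding cost_set_comp[OF \<nu> i] by simp
  have "grad_coeff \<nu> i \<mu> j * x \<mu> j \<le> grad_coeff \<nu> i \<mu> j * p \<mu> j"
    if \<mu>: "\<mu> \<in> {1..N}" and j: "j \<in> {1..n \<mu>}" for \<mu> j
  proof (cases "\<mu> = \<nu> \<and> j = i")
    case True
    then have "0 \<le> grad_coeff \<nu> i \<mu> j" "x \<mu> j \<le> p \<mu> j"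
      using diagonal_nonneg[OF \<nu> i] k ks by (auto simp: grad_coeff_def p_def set_comp_apply)
    then show ?thesis
      by (rule mult_left_mono[rotated])
  next
    case False
    then have "p \<mu> j = (if grad_coeff \<nu> i \<mu> j \<le> 0 then embed y \<mu> j else real_of_int (u \<mu> j))"
      unfolding p_def z_def S3_point_def partial_deriv_grad_comp[OF \<nu> i \<mu> j] embed_def set_comp_apply
      using partial_deriv_grad_comp[OF \<nu> i \<mu> j] by auto
    then show ?thesis
      using box(2)[OF \<mu> j] le_profileD[OF yx \<mu> j]
      by (auto intro: mult_left_mono mult_left_mono_neg)
  qed
  then have "affine_grad \<nu> i x \<le> affine_grad \<nu> i p"
    unfolding affine_grad_def by (intro add_right_mono sum_mono)
  then have "\<theta> \<nu> (set_comp x \<nu> i (x \<nu> i + 1)) < \<theta> \<nu> x"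
    unfolding cost_set_comp[OF \<nu> i] using p_descent by simp
  moreover have "\<theta> \<nu> x \<le> \<theta> \<nu> (set_comp x \<nu> i (x \<nu> i + 1))"
  proof -
    have "x \<nu> i + 1 \<le> real_of_int (u \<nu> i)" and "real_of_int (l \<nu> i) \<le> x \<nu> i + 1"
      using k ks \<open>s \<le> u \<nu> i\<close> box(1)[OF \<nu> i] by simp_all
    then have "(x \<nu>)(i := x \<nu> i + 1) \<in> strategies n l u \<nu> \<inter> integral_strategies n \<nu>"
      using box[OF \<nu>] i by (auto simp: strategies_def integral_strategies_def)
    then show ?thesis
      using nash \<nu> unfolding is_discrete_nash_def set_comp_def by blast
  qed
  ultimately show False
    by simp
qed

lemma gs_step_le_nash:
  assumes "gs_step N n \<theta> u \<sigma> \<sigma>'" and "gs_inv N n u \<sigma>"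
    and nash: "is_discrete_nash N n \<theta> l u x"
    and "le_profile N n (embed (current_point \<sigma>)) x"
  shows "le_profile N n (embed (current_point \<sigma>')) x"
  using assms(1)
proof cases
  case (3 y \<nu> i s w)
  then have "real_of_int s \<le> x \<nu> i"
    using assms(2,4) nash by (auto intro: S4_valid_le_nash)
  then show ?thesis
    using 3 assms(4) by (auto simp: le_profile_def embed_def set_comp_apply)
qed (use assms(4) in auto)

lemma gs_returns_le_nash:
  assumes N: "1 \<le> N" and n: "\<And>\<nu>. \<nu> \<in> {1..N} \<Longrightarrow> 1 \<le> n \<nu>" and lu: "le_profile N n l u"
    and nash: "is_discrete_nash N n \<theta> l u x"
    and ret: "gs_returns N n \<theta> l u lstar"
  shows "le_profile N n (embed lstar) x"
proof -
  have init: "gs_inv N n u (gs_init l)"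
    using lu by (simp add: gs_init_def le_profile_def)
  have lx: "le_profile N n (embed l) x"
    using nash by (auto simp: is_discrete_nash_def feasible_set_def strategies_def le_profile_def
        embed_def)
  have "le_profile N n (embed (current_point \<sigma>)) x"
    if "(gs_step N n \<theta> u)\<^sup>*\<^sup>* (gs_init l) \<sigma>" for \<sigma>
    using that
  proof (induction rule: rtranclp_induct)
    case base
    show ?case
      using lx by (simp add: gs_init_def)
  next
    case (step \<sigma> \<sigma>')
    have "gs_inv N n u \<sigma>"
      using gs_reachable_inv[OF step.hyps(1) init N n] .
    then show ?case
      using gs_step_le_nash step.hyps(2) nash step.IH by blast
  qed
  from this[of "Stop lstar"] show ?thesis
    using ret by (simp add: gs_returns_def)
qed

end

theorem theorem3p7:
  fixes N :: nat
    and n :: "nat \<Rightarrow> nat"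
    and \<theta> :: "nat \<Rightarrow> real profile \<Rightarrow> real"
    and Q :: "nat \<Rightarrow> nat \<Rightarrow> nat \<Rightarrow> real"
    and C :: "nat \<Rightarrow> nat \<Rightarrow> nat \<Rightarrow> nat \<Rightarrow> real"
    and b :: "nat \<Rightarrow> nat \<Rightarrow> real"
    and l u :: "int profile"
  assumes "1 \<le> N"
    and "\<And>\<nu>. \<nu> \<in> {1..N} \<Longrightarrow> 1 \<le> n \<nu>"
    and quadratic: "\<And>\<nu> x. \<nu> \<in> {1..N} \<Longrightarrow>
      \<theta> \<nu> x = 1/2 * (\<Sum>i=1..n \<nu>. x \<nu> i * (\<Sum>j=1..n \<nu>. Q \<nu> i j * x \<nu> j))
        + (\<Sum>i=1..n \<nu>. ((\<Sum>\<mu>\<in>{1..N} - {\<nu>}. \<Sum>j=1..n \<mu>. C \<nu> i \<mu> j * x \<mu> j) + b \<nu> i) * x \<nu> i)"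
    and "convex_in_own_variables N \<theta>"
    and "feasible_set N n l u \<noteq> {}"
    and "bounded_profiles N n (feasible_set N n l u)"
  shows "gs_terminates N n \<theta> l u \<and>
    (\<exists>lstar. gs_returns N n \<theta> l u lstar) \<and>
    (\<forall>lstar. gs_returns N n \<theta> l u lstar \<longrightarrow>
      (\<forall>x. is_discrete_nash N n \<theta> l u x \<longrightarrow>
        (\<forall>\<nu>\<in>{1..N}. \<forall>i\<in>{1..n \<nu>}. real_of_int (lstar \<nu> i) \<le> x \<nu> i)))"
proof -
  interpret quadratic_game N n \<theta> Q C b
    using quadratic assms(4) by unfold_locales
  have lu: "le_profile N n l u"
    using assms(5) by (force simp: feasible_set_def strategies_def le_profile_def)
  show ?thesis
    using gs_terminates_and_returns[OF assms(1,2) lu, where \<theta> = \<theta>]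
      gs_returns_le_nash[OF assms(1,2) lu]
    by (auto simp: le_profile_def embed_def)
qed

end
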